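(* Let $q$ be a power of a prime, let $n\ge2$ and $d\ge3$ be integers with $n\mid q-1$, let $f=\sum a_ix^i\in\mathbb F_q[x]$ be separable of degree $d$ with no root in $\mathbb F_q$, and let $\mathcal X$ be the smooth projective model of $y^n=f(x)$ over $\mathbb F_q$. Let $m$ be a positive divisor of $m(f)=\gcd(q-1,\{i:a_i\ne0\})$, let $\lambda\in\mathbb F_q^*$ have order $m$, write $f(x)=g(x^m)$ with $g\in\mathbb F_q[u]$, and assume $g(0)\notin(\mathbb F_q^* )^n$. If the group $H_m=\langle\tau,\sigma_\lambda\rangle$, generated by $\tau(x,y)=(x,\zeta_ny)$ ($\zeta_n\in\mathbb F_q$ a primitive $n$-th root of unity) and $\sigma_\lambda(x,y)=(\lambda x,y)$, acts transitively on the set $\mathcal Y$ of all $\mathbb F_q$-rational points of $\mathcal X$ lying over $\mathbb A^1(\mathbb F_q)$, then $W(\mathcal X)=\emptyset$. In particular $\mathcal X$ is not totally split.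
   Context: Put $c=\gcd(n,d)$, $g_{\mathcal X}=\frac{(n-1)(d-1)+1-c}{2}$ (the genus of $\mathcal X$), $\delta=\#\{a\in\mathbb F_q:f(a)\notin(\mathbb F_q^* )^n\}$, $M=\frac{(q-1)n}{c}-1$, $\mu(s)=\min\{s,M-s\}$ and $t(s)=2g_{\mathcal X}-2-c\,\mu(s)+n\delta$. The window of $\mathcal X$ is $W(\mathcal X)=\{s\in\mathbb Z_{\ge1}:t(s)<0\}$. $\mathcal X$ is totally split if $f(a)\in(\mathbb F_q^* )^n$ for every $a\in\mathbb F_q$, i.e. $\delta=0$. *)

theory Defs
  imports
    "HOL-Library.Cardinality"
    "HOL-Computational_Algebra.Computational_Algebra"
    "HOL-Algebra.Group_Action"
    "HOL-Algebra.Generated_Groups"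
begin

text \<open>
  The field \<open>\<F>\<^sub>q\<close> is a type \<open>'a :: finite_field\<close>, with \<open>q = CARD('a)\<close>. The number \<open>d\<close>
  is \<open>degree f\<close>.
\<close>

section \<open>The numerical data\<close>

definition elem_order :: "'a::field \<Rightarrow> nat" where
  "elem_order a = (LEAST k. 0 < k \<and> a ^ k = 1)"

definition unit_powers :: "nat \<Rightarrow> 'a::field set" where
  "unit_powers n = {b ^ n | b. b \<noteq> 0}"

definition totally_split :: "nat \<Rightarrow> 'a::finite_field poly \<Rightarrow> bool" where
  "totally_split n f \<longleftrightarrow> (\<forall>a. poly f a \<in> unit_powers n)"

definition num_non_split :: "nat \<Rightarrow> 'a::finite_field poly \<Rightarrow> nat" where
  "num_non_split n f = card {a. poly f a \<notin> unit_powers n}"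

definition curve_c :: "nat \<Rightarrow> 'a::finite_field poly \<Rightarrow> int" where
  "curve_c n f = int (gcd n (degree f))"

text \<open>The numerator is even whatever the parities of \<open>n\<close> and \<open>d\<close>, so the division is exact.\<close>

definition curve_genus :: "nat \<Rightarrow> 'a::finite_field poly \<Rightarrow> int" where
  "curve_genus n f = ((int n - 1) * (int (degree f) - 1) + 1 - curve_c n f) div 2"

text \<open>Again exact, since \<open>c\<close> divides \<open>n\<close>.\<close>

definition window_M :: "nat \<Rightarrow> 'a::finite_field poly \<Rightarrow> int" where
  "window_M n f = (int CARD('a) - 1) * int n div curve_c n f - 1"

definition window_mu :: "nat \<Rightarrow> 'a::finite_field poly \<Rightarrow> int \<Rightarrow> int" where
  "window_mu n f s = min s (window_M n f - s)"

definition window_t :: "nat \<Rightarrow> 'a::finite_field poly \<Rightarrow> int \<Rightarrow> int" where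
  "window_t n f s =
     2 * curve_genus n f - 2 - curve_c n f * window_mu n f s + int n * int (num_non_split n f)"

definition curve_window :: "nat \<Rightarrow> 'a::finite_field poly \<Rightarrow> int set" where
  "curve_window n f = {s. 1 \<le> s \<and> window_t n f s < 0}"

definition exponent_gcd :: "'a::finite_field poly \<Rightarrow> nat" where
  "exponent_gcd f = Gcd (insert (CARD('a) - 1) {i. coeff f i \<noteq> 0})"

section \<open>The curve and its points\<close>

text \<open>
  The smooth projective model of \<open>y\<^sup>n = f(x)\<close> is the nonsingular projective curve whose function field
  is \<open>L = \<F>\<^sub>q(x, y)\<close>. It is represented by this field together with its places: the
  points of the curve are the valuation rings of \<open>L\<close> over \<open>\<F>\<^sub>q\<close> (Hartshorne I.6, Stichtenoth I.1).
  The embedding \<open>emb\<close> is the inclusion of the constants. The last two assumptions say that \<open>x\<close> is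
  transcendental over \<open>\<F>\<^sub>q\<close> and that every element of \<open>L\<close> is of the form \<open>A(x, y) / B(x, y)\<close>.
\<close>

definition eval2 :: "('a::field \<Rightarrow> 'l::field) \<Rightarrow> 'l \<Rightarrow> 'l \<Rightarrow> 'a poly poly \<Rightarrow> 'l" where
  "eval2 emb x y A = poly (map_poly (\<lambda>p. poly (map_poly emb p) x) A) y"

locale curve_function_field =
  fixes emb :: "'a::finite_field \<Rightarrow> 'l::field" and x y :: 'l and n :: nat and f :: "'a poly"
  assumes emb_one: "emb 1 = 1"
    and emb_add: "emb (a + b) = emb a + emb b"
    and emb_mult: "emb (a * b) = emb a * emb b"
    and curve_equation: "y ^ n = poly (map_poly emb f) x"
    and x_transcendental: "poly (map_poly emb p) x = 0 \<Longrightarrow> p = 0"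
    and generated: "\<exists>A B. eval2 emb x y B \<noteq> 0 \<and> z = eval2 emb x y A / eval2 emb x y B"

definition valuation_ring_over :: "('a::field \<Rightarrow> 'l::field) \<Rightarrow> 'l set \<Rightarrow> bool" where
  "valuation_ring_over emb V \<longleftrightarrow>
     range emb \<subset> V \<and> V \<subset> UNIV \<and>
     (\<forall>u\<in>V. \<forall>v\<in>V. u - v \<in> V \<and> u * v \<in> V) \<and>
     (\<forall>z. z \<in> V \<or> inverse z \<in> V)"

definition non_units :: "'l::field set \<Rightarrow> 'l set" where
  "non_units V = {z \<in> V. \<not> (\<exists>w\<in>V. z * w = 1)}"

text \<open>
  A point is rational when its residue field \<open>V / non_units V\<close> is \<open>\<F>\<^sub>q\<close>, i.e. when every \<open>z \<in> V\<close> is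
  congruent to a constant. It lies over \<open>a \<in> \<A>\<^sup>1(\<F>\<^sub>q)\<close> when \<open>x\<close> takes the value \<open>a\<close> there.
\<close>

definition rational_points :: "('a::field \<Rightarrow> 'l::field) \<Rightarrow> 'l set set" where
  "rational_points emb =
     {V. valuation_ring_over emb V \<and> (\<forall>z\<in>V. \<exists>a. z - emb a \<in> non_units V)}"

definition affine_rational_points :: "('a::field \<Rightarrow> 'l::field) \<Rightarrow> 'l \<Rightarrow> 'l set set" where
  "affine_rational_points emb x =
     {V \<in> rational_points emb. \<exists>a. x - emb a \<in> non_units V}"

section \<open>Automorphisms\<close>

definition automorphism_over :: "('a::field \<Rightarrow> 'l::field) \<Rightarrow> ('l \<Rightarrow> 'l) \<Rightarrow> bool" where
  "automorphism_over emb h \<longleftrightarrow>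
     bij h \<and> (\<forall>u v. h (u + v) = h u + h v) \<and> (\<forall>u v. h (u * v) = h u * h v) \<and>
     (\<forall>a. h (emb a) = emb a)"

text \<open>
  An automorphism of the curve is given by its pullback \<open>h\<close> on \<open>L\<close>; so \<open>(x, y) \<mapsto> (x, \<zeta> y)\<close> is the
  \<open>h\<close> with \<open>h x = x\<close> and \<open>h y = \<zeta> y\<close>. The automorphism sends a point \<open>V\<close> to \<open>h -` V\<close>. To obtain a left
  action of the group of pullbacks, \<open>h\<close> is made to act by \<open>V \<mapsto> h ` V\<close>, i.e. as the inverse of the
  curve automorphism it comes from; a group and its inverses have the same orbits.
\<close>

definition point_action :: "'l set set \<Rightarrow> ('l \<Rightarrow> 'l) \<Rightarrow> 'l set \<Rightarrow> 'l set" where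
  "point_action Y h = (\<lambda>V\<in>Y. h ` V)"

end

theory Submission
  imports Defs
begin

text \<open>
  Call \<open>a \<in> \<F>\<^sub>q\<close> split if \<open>f(a)\<close> is a nonzero \<open>n\<close>-th power. The group generated by \<open>\<tau>\<close> and \<open>\<sigma>\<close> acts on
  the \<open>x\<close>-coordinates of points through multiplication by powers of \<open>\<kappa>\<close>. So if every split \<open>a\<close> is the
  \<open>x\<close>-coordinate of some rational point, transitivity puts all split values into a single orbit
  of the group \<open>\<langle>\<kappa>\<rangle>\<close>, which has at most \<open>m\<close> elements, and \<open>\<delta> \<ge> q - m\<close>.

  This bound is enough to make \<open>t(s)\<close> nonnegative for every \<open>s\<close> (\<open>window_empty\<close>). As \<open>m\<close> divides
  \<open>q - 1\<close>, either \<open>2m \<le> q - 1\<close> and the term \<open>n \<delta>\<close> is larger than the greatest value of \<open>c \<mu>(s)\<close>, which is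
  at most \<open>n (q - 1) / 2\<close>; or \<open>m = q - 1\<close>, and then \<open>q - 1\<close> divides \<open>d\<close>, so that the genus is
  large enough. That \<open>f\<close> is not totally split is seen at \<open>0\<close>, where \<open>f(0) = g(0)\<close>.

  The geometric input is the existence of a rational point over each split \<open>a\<close>, that is, of a
  valuation ring of \<open>L\<close> with residue field \<open>\<F>\<^sub>q\<close> in which \<open>x - a\<close> is not a unit
  (\<open>rational_point_over_a\<close>). It is given explicitly as the local ring of the affine curve at \<open>(a, b)\<close>,
  where \<open>b\<^sup>n = f(a)\<close>: the fractions of elements of \<open>R = \<F>\<^sub>q[x, y]\<close> whose denominators lie outside the
  ideal \<open>I = (x - a, y - b)\<close>. Two things have to be checked. The ideal \<open>I\<close> must be proper, i.e. \<open>(a, b)\<close>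
  must lie on the curve (\<open>one_notin_I\<close>); and every nonzero element must be a power of \<open>x - a\<close> times a unit
  (\<open>power_times_unit\<close>). For the latter, \<open>x - a\<close> generates the maximal ideal because the
  derivative \<open>n b\<^bsup>n-1\<^esup>\<close> of \<open>y\<^sup>n\<close> does not vanish at \<open>b\<close> (\<open>I_eq_p_mult\<close>), and no nonzero element is divisible by all
  powers of \<open>x - a\<close>. Properness and the last fact both come from the norm \<open>N(u) = \<Prod>\<^sub>i \<tau>\<^sup>i(u)\<close>, which
  maps \<open>R\<close> to \<open>\<F>\<^sub>q[x]\<close> (\<open>Nm_is_polynomial\<close>) and reduces both questions to polynomials in one variable.
\<close>

section \<open>Roots of unity in a finite field\<close>

lemma elem_order_pos_power:
  fixes a :: "'a::finite_field"
  assumes "a \<noteq> 0"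
  shows "0 < elem_order a \<and> a ^ elem_order a = 1"
  unfolding elem_order_def
proof (rule LeastI_ex)
  have card: "1 < CARD('a)"
    using card_mono[of "UNIV :: 'a set" "{0, 1}"] by simp
  have "a * a ^ (CARD('a) - 1) = a * 1"
    using finite_field_power_card_eq_same[of a] card by (simp flip: power_Suc)
  then have "a ^ (CARD('a) - 1) = 1"
    using assms by simp
  with card show "\<exists>k. 0 < k \<and> a ^ k = 1"
    by (intro exI[of _ "CARD('a) - 1"]) auto
qed

lemma power_below_elem_order: "0 < k \<Longrightarrow> k < elem_order a \<Longrightarrow> a ^ k \<noteq> 1"
  unfolding elem_order_def using not_less_Least by blast

text \<open>
  The characteristic divides \<open>q\<close>, because translation by \<open>1\<close> permutes the field and so adds \<open>q\<close> times
  \<open>1\<close> to the sum of all elements without changing it. It cannot divide \<open>q - 1\<close> as well.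
\<close>

lemma of_nat_divisor_card_minus_one_nonzero:
  assumes "n dvd CARD('a) - 1"
  shows "of_nat n \<noteq> (0 :: 'a::finite_field)"
proof
  assume "of_nat n = (0 :: 'a)"
  then have "of_nat (CARD('a) - 1) = (0 :: 'a)"
    using assms by (metis dvd_def mult_zero_left of_nat_mult)
  moreover have "of_nat CARD('a) = (0 :: 'a)"
  proof -
    have "bij ((+) 1 :: 'a \<Rightarrow> 'a)" by (intro o_bij[where g = "\<lambda>a. a - 1"]) (auto simp: fun_eq_iff)
    then have "(\<Sum>a\<in>UNIV. 1 + a) = (\<Sum>a\<in>UNIV. a :: 'a)"
      by (rule sum.reindex_bij_betw)
    then show ?thesis by (simp add: sum.distrib)
  qed
  moreover have "CARD('a) = Suc (CARD('a) - 1)"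
    by (simp add: finite_UNIV_card_ge_0)
  ultimately show False
    by (metis add.right_neutral of_nat_Suc one_neq_zero)
qed

lemma inj_on_powers_of_primitive_root:
  fixes w :: "'a::field"
  assumes "w \<noteq> 0" and prim: "\<And>k. 0 < k \<Longrightarrow> k < n \<Longrightarrow> w ^ k \<noteq> 1"
  shows "inj_on (\<lambda>i. w ^ i) {..<n}"
proof (rule linorder_inj_onI')
  fix i j assume "i \<in> {..<n}" "j \<in> {..<n}" "i < j"
  then have "w ^ (j - i) \<noteq> 1" by (intro prim) auto
  moreover have "w ^ j = w ^ (j - i) * w ^ i"
    using \<open>i < j\<close> by (simp flip: power_add)
  ultimately show "w ^ i \<noteq> w ^ j"
    using \<open>w \<noteq> 0\<close> by auto
qed

text \<open>
  The homogeneous form of the factorisation of \<open>X\<^sup>n - 1\<close>, whose two sides are monic of degree \<open>n\<close> with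
  the same \<open>n\<close> roots.
\<close>

lemma prod_primitive_root_minus:
  fixes w b z :: "'a::field"
  assumes root: "w ^ n = 1" and prim: "\<And>k. 0 < k \<Longrightarrow> k < n \<Longrightarrow> w ^ k \<noteq> 1" and n: "n > 0"
  shows "(\<Prod>i<n. b - w ^ i * z) = b ^ n - z ^ n"
proof (cases "z = 0")
  case True
  then show ?thesis using n by simp
next
  case False
  have w: "w \<noteq> 0" using root n by (auto simp: zero_power)
  have inj: "inj_on (\<lambda>i. w ^ i) {..<n}"
    by (rule inj_on_powers_of_primitive_root[OF w prim])
  let ?P = "\<Prod>i<n. [:- (w ^ i), 1:]" and ?Q = "monom 1 n - 1 :: 'a poly"
  have deg: "degree ?P = n"
    by (subst degree_prod_sum_eq) auto
  have lead: "coeff ?P n = 1"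
    using lead_coeff_prod[of "\<lambda>i. [:- (w ^ i), 1:]" "{..<n}"] deg by simp
  have degQ: "degree ?Q \<le> n"
    by (intro degree_diff_le) (auto simp: degree_monom_le)
  have "?P = ?Q"
  proof (rule poly_eqI_degree_lead_coeff[where n = n and A = "(\<lambda>i. w ^ i) ` {..<n}"])
    show "coeff ?P n = coeff ?Q n" using lead n by (simp add: coeff_eq_0)
    show "n \<le> card ((\<lambda>i. w ^ i) ` {..<n})" using inj by (simp add: card_image)
    fix u assume "u \<in> (\<lambda>i. w ^ i) ` {..<n}"
    then obtain j where j: "j < n" "u = w ^ j" by auto
    have "poly ?P u = 0" using j by (auto simp: poly_prod)
    moreover have "(w ^ j) ^ n = 1" using root by (metis power_mult mult.commute power_one)
    ultimately show "poly ?P u = poly ?Q u" using j by (simp add: poly_monom)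
  qed (use deg degQ in auto)
  then have "poly ?P (b / z) = poly ?Q (b / z)" by simp
  then have id: "(\<Prod>i<n. b / z - w ^ i) = (b / z) ^ n - 1"
    by (simp add: poly_prod poly_monom)
  have "(\<Prod>i<n. b - w ^ i * z) = (\<Prod>i<n. z * (b / z - w ^ i))"
    using False by (intro prod.cong) (auto simp: field_simps)
  also have "\<dots> = z ^ n * ((b / z) ^ n - 1)"
    by (simp only: prod.distrib id prod_constant card_lessThan)
  also have "\<dots> = b ^ n - z ^ n"
    using False by (simp add: field_simps power_divide)
  finally show ?thesis .
qed

lemma sum_powers_root_of_unity:
  fixes w :: "'a::field"
  assumes "w ^ n = 1" and "w \<noteq> 1"
  shows "(\<Sum>i<n. w ^ i) = 0"
  using assms by (simp add: sum_gp_strict)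

section \<open>The ring generated by x and y\<close>

locale kummer_curve = curve_function_field emb x y n f
  for emb :: "'a::finite_field \<Rightarrow> 'l::field" and x y :: 'l and n :: nat and f :: "'a poly" +
  fixes \<tau> :: "'l \<Rightarrow> 'l" and \<zeta> :: 'a
  assumes tau: "automorphism_over emb \<tau>" and tau_x: "\<tau> x = x" and tau_y: "\<tau> y = emb \<zeta> * y"
    and zeta_power: "\<zeta> ^ n = 1" and zeta_primitive: "\<And>k. 0 < k \<Longrightarrow> k < n \<Longrightarrow> \<zeta> ^ k \<noteq> 1"
    and n_pos: "n > 0" and n_nonzero: "of_nat n \<noteq> (0 :: 'a)"
begin

lemma emb_0 [simp]: "emb 0 = 0"
  using emb_add[of 0 0] by (metis add_cancel_right_right add_0)

lemma emb_uminus: "emb (- a) = - emb a"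
  using emb_add[of a "- a"] by (simp add: eq_neg_iff_add_eq_0 add.commute)

lemma emb_diff: "emb (a - b) = emb a - emb b"
  using emb_add[of a "- b"] by (simp add: emb_uminus)

lemma emb_power: "emb (a ^ k) = emb a ^ k"
  by (induction k) (auto simp: emb_one emb_mult)

lemma emb_of_nat: "emb (of_nat k) = of_nat k"
  by (induction k) (auto simp: emb_one emb_add)

lemma emb_eq_0_iff [simp]: "emb a = 0 \<longleftrightarrow> a = 0"
proof
  assume "emb a = 0"
  then have "poly (map_poly emb [:a:]) x = 0"
    by (simp add: map_poly_pCons)
  then show "a = 0"
    using x_transcendental by fastforce
qed simp

lemma emb_eq_iff: "emb a = emb b \<longleftrightarrow> a = b"
  using emb_eq_0_iff[of "a - b"] by (simp add: emb_diff)

text \<open>\<open>ev\<close> identifies the polynomial ring \<open>\<F>\<^sub>q[X]\<close> with the subring \<open>\<F>\<^sub>q[x]\<close> of \<open>L\<close>.\<close>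

definition ev :: "'a poly \<Rightarrow> 'l" where
  "ev p = poly (map_poly emb p) x"

lemma ev_0 [simp]: "ev 0 = 0"
  by (simp add: ev_def)

lemma ev_pCons: "ev (pCons c p) = emb c + x * ev p"
  by (simp add: ev_def map_poly_pCons)

lemma ev_1 [simp]: "ev 1 = 1"
  by (simp add: one_pCons ev_pCons emb_one)

lemma ev_add: "ev (p + q) = ev p + ev q"
proof (induction p arbitrary: q)
  case (pCons c p)
  then show ?case
    by (cases q) (auto simp: ev_pCons emb_add algebra_simps)
qed auto

lemma ev_smult: "ev (smult c p) = emb c * ev p"
  by (induction p) (auto simp: ev_pCons emb_mult algebra_simps)

lemma ev_mult: "ev (p * q) = ev p * ev q"
  by (induction p) (auto simp: ev_pCons ev_add ev_smult algebra_simps)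

lemma ev_power: "ev (p ^ k) = ev p ^ k"
  by (induction k) (auto simp: ev_mult)

lemma ev_eq_0_iff [simp]: "ev p = 0 \<longleftrightarrow> p = 0"
  using x_transcendental[of p] by (auto simp: ev_def)

lemma ev_eq_iff: "ev p = ev q \<longleftrightarrow> p = q"
proof
  assume "ev p = ev q"
  moreover have "ev p = ev (p - q) + ev q" by (simp flip: ev_add)
  ultimately have "ev (p - q) = 0" by simp
  then show "p = q" by simp
qed simp

lemma y_power_n: "y ^ n = ev f"
  using curve_equation by (simp add: ev_def)

lemma ev_remainder: "ev p = emb (poly p a) + (x - emb a) * ev (synthetic_div p a)"
proof -
  have "ev p = ev ([:- a, 1:] * synthetic_div p a + [:poly p a:])"
    by (simp only: synthetic_div_correct')
  also have "\<dots> = (x - emb a) * ev (synthetic_div p a) + emb (poly p a)"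
    by (simp only: ev_add ev_mult) (simp add: ev_pCons emb_one emb_uminus)
  finally show ?thesis by simp
qed

text \<open>
  The coordinate ring \<open>\<F>\<^sub>q[x, y]\<close>. It is described as the additive span of the monomials in \<open>y\<close>, since
  this makes additive statements about it, such as that on traces, inductions over single monomials.
\<close>

inductive_set R :: "'l set" where
  monomial: "ev p * y ^ j \<in> R"
| add: "u \<in> R \<Longrightarrow> v \<in> R \<Longrightarrow> u + v \<in> R"

lemma R_ev: "ev p \<in> R"
  using monomial[of p 0] by simp

lemma R_emb: "emb c \<in> R"
  using R_ev[of "[:c:]"] by (simp add: ev_pCons)

lemma R_0: "0 \<in> R" and R_1: "1 \<in> R"
  using R_emb[of 0] R_emb[of 1] by (simp_all add: emb_one)

lemma R_x: "x \<in> R"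
  using R_ev[of "[:0, 1:]"] by (simp add: ev_pCons emb_one)

lemma R_y: "y \<in> R"
  using monomial[of 1 1] by simp

lemma R_mult_monomial: "u \<in> R \<Longrightarrow> u * (ev q * y ^ k) \<in> R"
proof (induction rule: R.induct)
  case (monomial p j)
  have "ev p * y ^ j * (ev q * y ^ k) = ev (p * q) * y ^ (j + k)"
    by (simp add: ev_mult power_add)
  then show ?case using R.monomial by metis
next
  case (add u v)
  then show ?case by (simp add: R.add distrib_right)
qed

lemma R_mult: assumes u: "u \<in> R" and "v \<in> R" shows "u * v \<in> R"
  using assms(2)
  by induction (simp_all add: R_mult_monomial[OF u] R.add distrib_left)

lemma R_diff: "u \<in> R \<Longrightarrow> v \<in> R \<Longrightarrow> u - v \<in> R"
  using R.add[OF _ R_mult[OF R_emb[of "- 1"]], of u v] by (simp add: emb_uminus emb_one)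

lemma R_power: "u \<in> R \<Longrightarrow> u ^ k \<in> R"
  by (induction k) (auto simp: R_1 R_mult)

lemma R_sum: "(\<And>i. i \<in> A \<Longrightarrow> h i \<in> R) \<Longrightarrow> sum h A \<in> R"
  by (induction A rule: infinite_finite_induct) (auto simp: R_0 R.add)

lemma R_prod: "(\<And>i. i \<in> A \<Longrightarrow> h i \<in> R) \<Longrightarrow> prod h A \<in> R"
  by (induction A rule: infinite_finite_induct) (auto simp: R_1 R_mult)

lemma eval2_in_R: "eval2 emb x y A \<in> R"
proof (induction A)
  case 0
  then show ?case by (simp add: eval2_def R_0)
next
  case (pCons p A)
  have "eval2 emb x y (pCons p A) = ev p + y * eval2 emb x y A"
    by (simp add: eval2_def map_poly_pCons ev_def)
  then show ?case using pCons by (simp add: R.add R_ev R_mult R_y)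
qed

lemma fraction_of_R: obtains u v where "u \<in> R" "v \<in> R" "v \<noteq> 0" "z = u / v"
  using generated[of z] eval2_in_R by blast

section \<open>The norm to the polynomials in x\<close>

lemma tau_iterate_ring_hom:
  shows "(\<tau> ^^ i) (u + v) = (\<tau> ^^ i) u + (\<tau> ^^ i) v"
    and "(\<tau> ^^ i) (u * v) = (\<tau> ^^ i) u * (\<tau> ^^ i) v"
    and "(\<tau> ^^ i) (emb a) = emb a"
    and "(\<tau> ^^ i) x = x"
    and "(\<tau> ^^ i) y = emb \<zeta> ^ i * y"
proof -
  have t: "\<And>u v. \<tau> (u + v) = \<tau> u + \<tau> v" "\<And>u v. \<tau> (u * v) = \<tau> u * \<tau> v" "\<And>a. \<tau> (emb a) = emb a"
    using tau by (auto simp: automorphism_over_def)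
  have tp: "\<tau> (emb \<zeta> ^ i) = emb \<zeta> ^ i" for i
    using t(3)[of "\<zeta> ^ i"] by (simp add: emb_power)
  show "(\<tau> ^^ i) (u + v) = (\<tau> ^^ i) u + (\<tau> ^^ i) v"
    by (induction i) (auto simp: t)
  show "(\<tau> ^^ i) (u * v) = (\<tau> ^^ i) u * (\<tau> ^^ i) v"
    by (induction i) (auto simp: t)
  show "(\<tau> ^^ i) (emb a) = emb a"
    by (induction i) (auto simp: t)
  show "(\<tau> ^^ i) x = x"
    by (induction i) (auto simp: tau_x)
  show "(\<tau> ^^ i) y = emb \<zeta> ^ i * y"
    by (induction i) (auto simp: t tp tau_y)
qed

lemma tau_iterate_0: "(\<tau> ^^ i) 0 = 0"
  using tau_iterate_ring_hom(3)[of i 0] by simp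

lemma tau_iterate_1: "(\<tau> ^^ i) 1 = 1"
  using tau_iterate_ring_hom(3)[of i 1] by (simp add: emb_one)

lemma tau_iterate_diff: "(\<tau> ^^ i) (u - v) = (\<tau> ^^ i) u - (\<tau> ^^ i) v"
  using tau_iterate_ring_hom(1)[of i "u - v" v] by simp

lemma tau_iterate_power: "(\<tau> ^^ i) (u ^ k) = (\<tau> ^^ i) u ^ k"
  by (induction k) (auto simp: tau_iterate_1 tau_iterate_ring_hom)

lemma tau_iterate_ev: "(\<tau> ^^ i) (ev p) = ev p"
  by (induction p) (auto simp: ev_pCons tau_iterate_ring_hom tau_iterate_0)

lemma tau_iterate_nonzero: "u \<noteq> 0 \<Longrightarrow> (\<tau> ^^ i) u \<noteq> 0"
  using tau_iterate_ring_hom(2)[of i u "inverse u"] tau_iterate_1[of i] by auto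

lemma tau_iterate_R: "u \<in> R \<Longrightarrow> (\<tau> ^^ i) u \<in> R"
  by (induction rule: R.induct)
    (auto simp: tau_iterate_ring_hom tau_iterate_ev tau_iterate_power R.add
      intro!: R_mult R_ev R_power R_y R_emb)

lemma tau_n_R: "u \<in> R \<Longrightarrow> (\<tau> ^^ n) u = u"
  by (induction rule: R.induct)
    (auto simp: tau_iterate_ring_hom tau_iterate_ev tau_iterate_power emb_power[symmetric]
      zeta_power emb_one)

text \<open>
  The trace multiplies \<open>p(x) y\<^sup>j\<close> by \<open>\<Sum>\<^sub>i \<zeta>\<^bsup>ij\<^esup>\<close>, which vanishes unless \<open>n\<close> divides \<open>j\<close>; and if it does, \<open>y\<^sup>j\<close>
  is a power of \<open>f(x)\<close>.
\<close>

lemma trace_R: "u \<in> R \<Longrightarrow> \<exists>Q. (\<Sum>i<n. (\<tau> ^^ i) u) = ev Q"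
proof (induction rule: R.induct)
  case (monomial p j)
  let ?w = "emb \<zeta> ^ j"
  have "(\<Sum>i<n. (\<tau> ^^ i) (ev p * y ^ j)) = (\<Sum>i<n. ?w ^ i) * (ev p * y ^ j)"
    by (simp add: tau_iterate_ring_hom tau_iterate_ev tau_iterate_power sum_distrib_right
        sum_distrib_left power_mult_distrib mult_ac flip: power_mult)
  moreover have "\<exists>Q. (\<Sum>i<n. ?w ^ i) * (ev p * y ^ j) = ev Q"
  proof (cases "n dvd j")
    case True
    then obtain k where k: "j = n * k" by auto
    have "?w = 1" by (simp add: k power_mult emb_power[symmetric] zeta_power emb_one)
    then have "(\<Sum>i<n. ?w ^ i) * (ev p * y ^ j) = ev (smult (of_nat n) (p * f ^ k))"
      by (simp add: ev_smult emb_of_nat ev_mult ev_power k power_mult y_power_n)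
    then show ?thesis by blast
  next
    case False
    have "\<zeta> ^ (j mod n) \<noteq> 1"
      using False n_pos by (intro zeta_primitive) (auto simp: mod_eq_0_iff_dvd intro: Nat.gr0I)
    moreover have "\<zeta> ^ j = \<zeta> ^ (n * (j div n) + j mod n)" by simp
    ultimately have "\<zeta> ^ j \<noteq> 1"
      by (simp only: power_add power_mult zeta_power) simp
    then have "?w \<noteq> 1" by (metis emb_power emb_one emb_eq_iff)
    moreover have "?w ^ n = 1"
      by (metis emb_power emb_one zeta_power power_mult mult.commute power_one)
    ultimately have "(\<Sum>i<n. ?w ^ i) = 0" by (intro sum_powers_root_of_unity)
    then show ?thesis by (intro exI[of _ 0]) simp
  qed
  ultimately show ?case by metis
next
  case (add u v)
  then obtain Q Q' where "(\<Sum>i<n. (\<tau> ^^ i) u) = ev Q" "(\<Sum>i<n. (\<tau> ^^ i) v) = ev Q'" by auto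
  then show ?case
    by (intro exI[of _ "Q + Q'"]) (simp add: tau_iterate_ring_hom sum.distrib ev_add)
qed

definition Nm :: "'l \<Rightarrow> 'l" where
  "Nm u = (\<Prod>i<n. (\<tau> ^^ i) u)"

lemma Nm_mult: "Nm (u * v) = Nm u * Nm v"
  by (simp add: Nm_def tau_iterate_ring_hom prod.distrib)

lemma Nm_1: "Nm 1 = 1"
  by (simp add: Nm_def tau_iterate_1)

lemma Nm_nonzero: "u \<noteq> 0 \<Longrightarrow> Nm u \<noteq> 0"
  by (simp add: Nm_def tau_iterate_nonzero)

lemma Nm_R: "u \<in> R \<Longrightarrow> Nm u \<in> R"
  by (auto simp: Nm_def intro!: R_prod tau_iterate_R)

lemma Nm_ev: "Nm (ev p) = ev (p ^ n)"
  by (simp add: Nm_def tau_iterate_ev ev_power)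

text \<open>Applying \<open>\<tau>\<close> permutes the factors cyclically.\<close>

lemma tau_Nm: assumes "u \<in> R" shows "\<tau> (Nm u) = Nm u"
proof -
  have tprod: "\<tau> (prod h A) = (\<Prod>i\<in>A. \<tau> (h i))" if "finite A" for h and A :: "nat set"
    using that tau_iterate_1[of 1] tau_iterate_ring_hom(2)[of 1] by (induction A) auto
  have "\<tau> (Nm u) = (\<Prod>i<n. (\<tau> ^^ Suc i) u)" by (simp add: Nm_def tprod)
  moreover have "u * (\<Prod>i<n. (\<tau> ^^ Suc i) u) = (\<Prod>i<n. (\<tau> ^^ i) u) * (\<tau> ^^ n) u"
    using prod.lessThan_Suc[of "\<lambda>i. (\<tau> ^^ i) u" n] prod.lessThan_Suc_shift[of "\<lambda>i. (\<tau> ^^ i) u" n]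
    by (simp del: funpow.simps prod.lessThan_Suc)
  ultimately have "u * \<tau> (Nm u) = u * Nm u"
    using tau_n_R[OF assms] by (simp add: Nm_def mult.commute)
  then show ?thesis
    using tau_iterate_0[of 1] n_pos by (cases "u = 0") (auto simp: Nm_def tau_iterate_0 zero_power)
qed

text \<open>
  An element fixed by \<open>\<tau>\<close> is \<open>1/n\<close> times its own trace, and traces are polynomials in \<open>x\<close>.
\<close>

lemma Nm_is_polynomial: assumes "u \<in> R" shows "\<exists>Q. Nm u = ev Q"
proof -
  have fixed: "(\<tau> ^^ i) (Nm u) = Nm u" for i
    using tau_Nm[OF assms] by (induction i) auto
  obtain Q where "(\<Sum>i<n. (\<tau> ^^ i) (Nm u)) = ev Q"
    using trace_R[OF Nm_R[OF assms]] by blast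
  then have "of_nat n * Nm u = ev Q" by (simp add: fixed)
  moreover have "of_nat n = emb (of_nat n)" by (simp add: emb_of_nat)
  ultimately have "Nm u = ev (smult (inverse (of_nat n)) Q)"
    using n_nonzero
    by (simp add: ev_smult) (metis emb_mult emb_one left_inverse mult.assoc mult_1)
  then show ?thesis by blast
qed

text \<open>The cofactor is the product of the other conjugates of \<open>u\<close>, so the multiple is the norm.\<close>

lemma multiple_in_polynomials:
  assumes "u \<in> R" "u \<noteq> 0"
  shows "\<exists>Q D. D \<in> R \<and> Q \<noteq> 0 \<and> u * D = ev Q"
proof -
  obtain Q where Q: "Nm u = ev Q" using Nm_is_polynomial[OF assms(1)] by blast
  obtain k where k: "n = Suc k" using n_pos by (cases n) auto
  have "Nm u = u * (\<Prod>i<k. (\<tau> ^^ Suc i) u)"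
    unfolding Nm_def by (subst k, subst prod.lessThan_Suc_shift) simp
  moreover have "(\<Prod>i<k. (\<tau> ^^ Suc i) u) \<in> R"
    by (intro R_prod tau_iterate_R assms)
  moreover have "Q \<noteq> 0" using Nm_nonzero[OF assms(2)] Q by auto
  ultimately show ?thesis using Q by metis
qed

text \<open>
  Taking norms, an inverse of \<open>x - a\<close> in \<open>R\<close> would give an inverse of \<open>(X - a)\<^sup>n\<close> among polynomials.
\<close>

lemma x_minus_constant_not_unit: assumes "r \<in> R" shows "1 \<noteq> (x - emb a) * r"
proof
  assume "1 = (x - emb a) * r"
  then have "Nm 1 = Nm (ev [:- a, 1:]) * Nm r"
    by (simp add: Nm_mult[symmetric] ev_pCons emb_one emb_uminus)
  moreover obtain Q where "Nm r = ev Q" using Nm_is_polynomial[OF assms] by blast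
  ultimately have "ev 1 = ev ([:- a, 1:] ^ n * Q)" by (simp add: Nm_1 Nm_ev ev_mult)
  then have "poly 1 a = poly ([:- a, 1:] ^ n * Q) a" by (simp only: ev_eq_iff)
  then show False using n_pos by (simp add: zero_power)
qed

end

section \<open>The local ring at a split point\<close>

locale split_point = kummer_curve +
  fixes a b
  assumes b_nonzero: "b \<noteq> 0" and on_curve: "poly f a = b ^ n"
begin

definition p :: 'b where
  "p = x - emb a"

lemma ev_linear: "ev [:- a, 1:] = p"
  by (simp add: ev_pCons emb_one emb_uminus p_def)

text \<open>
  The ideal of \<open>R\<close> generated by \<open>x - a\<close> and \<open>y - b\<close>, which will be shown to be the maximal ideal of the
  point \<open>(a, b)\<close>.
\<close>

definition I :: "'b set" where
  "I = {p * r + (y - emb b) * s | r s. r \<in> R \<and> s \<in> R}"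

lemma p_nonzero: "p \<noteq> 0"
  using ev_eq_0_iff[of "[:- a, 1:]"] by (simp add: ev_linear)

lemma p_R: "p \<in> R"
  unfolding p_def by (intro R_diff R_x R_emb)

lemma I_subset_R: "u \<in> I \<Longrightarrow> u \<in> R"
  by (auto simp: I_def intro!: R.add R_mult R_diff p_R R_y R_emb)

lemma I_add: "u \<in> I \<Longrightarrow> v \<in> I \<Longrightarrow> u + v \<in> I"
proof -
  assume "u \<in> I" "v \<in> I"
  then obtain r s r' s' where "u = p * r + (y - emb b) * s" "v = p * r' + (y - emb b) * s'"
    and R: "r \<in> R" "s \<in> R" "r' \<in> R" "s' \<in> R" by (auto simp: I_def)
  then have "u + v = p * (r + r') + (y - emb b) * (s + s')" by (simp add: distrib_left)
  then show ?thesis using R unfolding I_def by (blast intro: R.add)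
qed

lemma I_mult: "u \<in> I \<Longrightarrow> v \<in> R \<Longrightarrow> v * u \<in> I"
proof -
  assume "u \<in> I" "v \<in> R"
  then obtain r s where "u = p * r + (y - emb b) * s" and R: "r \<in> R" "s \<in> R" by (auto simp: I_def)
  then have "v * u = p * (v * r) + (y - emb b) * (v * s)" by (simp add: distrib_left mult.left_commute)
  then show ?thesis using R \<open>v \<in> R\<close> unfolding I_def by (blast intro: R_mult)
qed

lemma I_0: "0 \<in> I"
  unfolding I_def using R_0 by force

lemma I_diff: "u \<in> I \<Longrightarrow> v \<in> I \<Longrightarrow> u - v \<in> I"
  using I_add[OF _ I_mult[OF _ R_emb[of "- 1"]], of u v] by (simp add: emb_uminus emb_one)

lemma p_mult_I: "r \<in> R \<Longrightarrow> p * r \<in> I"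
  unfolding I_def using R_0 by force

lemma y_mult_I: "r \<in> R \<Longrightarrow> (y - emb b) * r \<in> I"
  unfolding I_def using R_0 by force

text \<open>
  The constant is the value at \<open>(a, b)\<close>. It is only asserted to exist: evaluation at \<open>(a, b)\<close> is well defined
  on \<open>R\<close> only once \<open>I\<close> is known to be proper.
\<close>

lemma constant_plus_I: "u \<in> R \<Longrightarrow> \<exists>c. u - emb c \<in> I"
proof (induction rule: R.induct)
  case (monomial q j)
  have "ev q * y ^ j - emb (poly q a * b ^ j) =
      y ^ j * (ev q - emb (poly q a)) + emb (poly q a) * (y ^ j - emb b ^ j)"
    by (simp add: emb_mult emb_power algebra_simps)
  moreover have "ev q - emb (poly q a) \<in> I"
    by (subst ev_remainder[of q a]) (simp add: p_mult_I R_ev flip: p_def)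
  moreover have "y ^ j - emb b ^ j \<in> I"
    by (subst power_diff_sumr2) (intro y_mult_I R_sum R_mult R_power R_y R_emb)
  ultimately show ?case by (metis I_add I_mult R_power R_y R_emb)
next
  case (add u v)
  then obtain c d where "u - emb c \<in> I" "v - emb d \<in> I" by auto
  then have "(u + v) - emb (c + d) \<in> I" using I_add by (fastforce simp: emb_add algebra_simps)
  then show ?case by blast
qed

lemma y_power_minus: "y ^ n - emb b ^ n = p * ev (synthetic_div f a)"
  by (simp add: y_power_n ev_remainder[of f a] on_curve emb_power p_def)

text \<open>
  If \<open>I\<close> contained \<open>1\<close>, then \<open>1 - (x - a) r\<close> would be a multiple of \<open>y - b\<close> for some \<open>r\<close>. Its norm is
  \<open>1\<close> modulo \<open>x - a\<close>; but it is also a multiple of the norm of \<open>y - b\<close>, which up to sign is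
  \<open>y\<^sup>n - b\<^sup>n = f(x) - f(a)\<close>, a multiple of \<open>x - a\<close>. So \<open>x - a\<close> would be a unit of \<open>R\<close>.
\<close>

lemma one_notin_I: "1 \<notin> I"
proof
  assume "1 \<in> I"
  then obtain r s where rs: "1 = p * r + (y - emb b) * s" "r \<in> R" "s \<in> R" by (auto simp: I_def)
  \<comment> \<open>The norm of an element that is \<open>1\<close> modulo \<open>x - a\<close> is again \<open>1\<close> modulo \<open>x - a\<close>.\<close>
  have "\<exists>t\<in>R. (\<Prod>i<k. (\<tau> ^^ i) (1 - p * r)) = 1 - p * t" for k
  proof (induction k)
    case 0
    then show ?case by (intro bexI[of _ 0]) (auto simp: R_0)
  next
    case (Suc k)
    then obtain t where t: "t \<in> R" "(\<Prod>i<k. (\<tau> ^^ i) (1 - p * r)) = 1 - p * t" by blast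
    let ?r = "(\<tau> ^^ k) r"
    have "(\<tau> ^^ k) (1 - p * r) = 1 - p * ?r"
      by (simp add: tau_iterate_diff tau_iterate_1 tau_iterate_ring_hom p_def)
    then have "(\<Prod>i<Suc k. (\<tau> ^^ i) (1 - p * r)) = 1 - p * (t + ?r - p * t * ?r)"
      by (simp only: prod.lessThan_Suc t(2)) (simp add: algebra_simps)
    moreover have "t + ?r - p * t * ?r \<in> R"
      by (intro R_diff R.add R_mult p_R tau_iterate_R t rs)
    ultimately show ?case by blast
  qed
  then obtain t where t: "t \<in> R" "Nm (1 - p * r) = 1 - p * t" unfolding Nm_def by blast
  have one_diff: "1 - p * r = (- 1) * ((emb b - y) * s)"
    using rs(1) by (simp add: algebra_simps)
  have "Nm (emb b - y) = (\<Prod>i<n. emb b - emb \<zeta> ^ i * y)"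
    by (simp add: Nm_def tau_iterate_diff tau_iterate_ring_hom)
  also have "\<dots> = emb b ^ n - y ^ n"
  proof (rule prod_primitive_root_minus)
    show "emb \<zeta> ^ n = 1" by (metis emb_power emb_one zeta_power)
    show "emb \<zeta> ^ k \<noteq> 1" if "0 < k" "k < n" for k
      using zeta_primitive[OF that] by (metis emb_power emb_one emb_eq_iff)
  qed (rule n_pos)
  also have "\<dots> = - (p * ev (synthetic_div f a))"
    using y_power_minus by (simp add: algebra_simps)
  finally have N: "Nm (emb b - y) = - (p * ev (synthetic_div f a))" .
  have "1 - p * t = Nm (- 1) * (- (p * ev (synthetic_div f a)) * Nm s)"
    by (simp only: t(2)[symmetric] one_diff Nm_mult N)
  then have "1 = p * (t - Nm (- 1) * ev (synthetic_div f a) * Nm s)"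
    by (simp add: algebra_simps)
  moreover have "- 1 \<in> R" using R_emb[of "- 1"] by (simp add: emb_uminus emb_one)
  ultimately show False
    using x_minus_constant_not_unit[of _ a, folded p_def] R_diff R_mult R_ev Nm_R rs t by metis
qed

lemma constant_in_I: "emb c \<in> I \<Longrightarrow> c = 0"
proof (rule ccontr)
  assume "emb c \<in> I" "c \<noteq> 0"
  then have "emb (inverse c) * emb c \<in> I" by (intro I_mult R_emb)
  then show False using one_notin_I \<open>c \<noteq> 0\<close> by (simp add: emb_mult[symmetric] emb_one)
qed

lemma I_prime: assumes "u \<in> R" "v \<in> R" "u * v \<in> I" "u \<notin> I" shows "v \<in> I"
proof -
  obtain c where c: "u - emb c \<in> I" using constant_plus_I assms by blast
  have "c \<noteq> 0" using c assms by auto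
  have "v * (u - emb c) \<in> I" using c assms I_mult by blast
  then have "u * v - v * (u - emb c) \<in> I" using assms I_diff by blast
  then have "emb (inverse c) * (u * v - v * (u - emb c)) \<in> I" by (intro I_mult R_emb)
  moreover have "emb (inverse c) * (u * v - v * (u - emb c)) = emb (inverse c * c) * v"
    by (simp add: emb_mult algebra_simps)
  ultimately show ?thesis using \<open>c \<noteq> 0\<close> by (simp add: emb_one)
qed

text \<open>The local ring of the curve at \<open>(a, b)\<close>.\<close>

definition V :: "'b set" where
  "V = {u / v | u v. u \<in> R \<and> v \<in> R \<and> v \<notin> I}"

lemma VI: "u \<in> R \<Longrightarrow> v \<in> R \<Longrightarrow> v \<notin> I \<Longrightarrow> u / v \<in> V"
  by (auto simp: V_def)

lemma VE: assumes "z \<in> V" obtains u v where "u \<in> R" "v \<in> R" "v \<notin> I" "v \<noteq> 0" "z = u / v"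
  using assms I_0 by (auto simp: V_def)

lemma R_subset_V: "u \<in> R \<Longrightarrow> u \<in> V"
  using VI[of u 1] R_1 one_notin_I by simp

lemma V_diff: assumes "z \<in> V" "w \<in> V" shows "z - w \<in> V"
proof -
  obtain u v where z: "u \<in> R" "v \<in> R" "v \<notin> I" "v \<noteq> 0" "z = u / v" using assms by (elim VE)
  obtain u' v' where w: "u' \<in> R" "v' \<in> R" "v' \<notin> I" "v' \<noteq> 0" "w = u' / v'" using assms by (elim VE)
  have "z - w = (u * v' - u' * v) / (v * v')" using z w by (simp add: field_simps)
  then show ?thesis using z w I_prime by (metis VI R_diff R_mult)
qed

lemma V_mult: assumes "z \<in> V" "w \<in> V" shows "z * w \<in> V"
proof -
  obtain u v where z: "u \<in> R" "v \<in> R" "v \<notin> I" "v \<noteq> 0" "z = u / v" using assms by (elim VE)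
  obtain u' v' where w: "u' \<in> R" "v' \<in> R" "v' \<notin> I" "v' \<noteq> 0" "w = u' / v'" using assms by (elim VE)
  have "z * w = (u * u') / (v * v')" using z w by (simp add: field_simps)
  then show ?thesis using z w I_prime by (metis VI R_mult)
qed

lemma V_power: "z \<in> V \<Longrightarrow> z ^ k \<in> V"
  by (induction k) (auto intro: V_mult R_subset_V R_1)

lemma quotient_non_unit: assumes "u \<in> I" "v \<in> R" "v \<notin> I" shows "u / v \<in> non_units V"
proof -
  have "u / v \<in> V" using assms I_subset_R VI by blast
  moreover have "u / v * w \<noteq> 1" if w: "w \<in> V" for w
  proof
    assume eq: "u / v * w = 1"
    obtain u' v' where w: "u' \<in> R" "v' \<in> R" "v' \<notin> I" "v' \<noteq> 0" "w = u' / v'" using w by (elim VE)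
    have "v \<noteq> 0" using assms I_0 by auto
    then have "v * v' = u' * u" using eq w by (simp add: field_simps)
    then have "v * v' \<in> I" using I_mult assms w by simp
    then show False using I_prime assms w by blast
  qed
  ultimately show ?thesis by (auto simp: non_units_def)
qed

text \<open>
  It suffices to divide \<open>y - b\<close> by \<open>x - a\<close>. The product of \<open>y - b\<close> and \<open>E = \<Sum>\<^sub>i b\<^bsup>n-1-i\<^esup> y\<^sup>i\<close> is
  \<open>y\<^sup>n - b\<^sup>n\<close>, a multiple of \<open>x - a\<close>, and \<open>E\<close> is a unit of the local ring because its value at \<open>(a, b)\<close> is
  \<open>n b\<^bsup>n-1\<^esup> \<noteq> 0\<close>. Geometrically, \<open>x - a\<close> is a local parameter since the tangent is not vertical.
\<close>

lemma I_eq_p_mult: assumes "u \<in> I" shows "\<exists>w\<in>V. u = p * w"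
proof -
  obtain r s where rs: "u = p * r + (y - emb b) * s" "r \<in> R" "s \<in> R" using assms by (auto simp: I_def)
  let ?E = "\<Sum>i<n. emb b ^ (n - Suc i) * y ^ i"
  have E: "?E \<in> R" by (intro R_sum R_mult R_power R_y R_emb)
  have eq: "(y - emb b) * ?E = p * ev (synthetic_div f a)"
    using power_diff_sumr2[of y n "emb b"] y_power_minus by simp
  have "?E \<notin> I"
  proof
    assume "?E \<in> I"
    have "?E - of_nat n * emb b ^ (n - 1) = (\<Sum>i<n. emb b ^ (n - Suc i) * (y ^ i - emb b ^ i))"
    proof -
      have "emb b ^ (n - Suc i) * emb b ^ i = emb b ^ (n - 1)" if "i < n" for i
        using that by (simp flip: power_add)
      then have "(\<Sum>i<n. emb b ^ (n - Suc i) * emb b ^ i) = of_nat n * emb b ^ (n - 1)"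
        by simp
      then show ?thesis by (simp add: algebra_simps sum_subtractf)
    qed
    also have "\<dots> = (y - emb b) * (\<Sum>i<n. emb b ^ (n - Suc i) * (\<Sum>j<i. emb b ^ (i - Suc j) * y ^ j))"
      by (simp add: power_diff_sumr2 sum_distrib_left mult.left_commute)
    also have "\<dots> \<in> I"
      by (intro y_mult_I R_sum R_mult R_power R_y R_emb)
    finally have "?E - (?E - of_nat n * emb b ^ (n - 1)) \<in> I" by (rule I_diff[OF \<open>?E \<in> I\<close>])
    then have "emb (of_nat n * b ^ (n - 1)) \<in> I" by (simp add: emb_mult emb_power emb_of_nat)
    then show False using constant_in_I n_nonzero b_nonzero by fastforce
  qed
  then have w: "ev (synthetic_div f a) / ?E * s \<in> V"
    using E rs by (intro V_mult VI R_subset_V R_ev)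
  have "?E \<noteq> 0" using \<open>?E \<notin> I\<close> I_0 by metis
  then have "y - emb b = p * (ev (synthetic_div f a) / ?E)" using eq by (simp add: field_simps)
  then have "u = p * (r - (0 - ev (synthetic_div f a) / ?E * s))"
    by (simp add: rs(1) distrib_left mult.assoc)
  moreover have "r - (0 - ev (synthetic_div f a) / ?E * s) \<in> V"
    by (intro V_diff w R_subset_V R_0 rs)
  ultimately show ?thesis by blast
qed

text \<open>The units of the local ring \<open>V\<close>.\<close>

definition U :: "'b set" where
  "U = {u / v | u v. u \<in> R \<and> u \<notin> I \<and> v \<in> R \<and> v \<notin> I}"

lemma U_subset_V: "z \<in> U \<Longrightarrow> z \<in> V" and U_inverse: "z \<in> U \<Longrightarrow> inverse z \<in> U"
  and U_nonzero: "z \<in> U \<Longrightarrow> z \<noteq> 0"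
  by (force simp: U_def V_def I_0)+

lemma U_mult: assumes "z \<in> U" "w \<in> U" shows "z * w \<in> U"
proof -
  obtain u v u' v' where *: "u \<in> R" "u \<notin> I" "v \<in> R" "v \<notin> I" "z = u / v"
    "u' \<in> R" "u' \<notin> I" "v' \<in> R" "v' \<notin> I" "w = u' / v'" using assms by (auto simp: U_def)
  have "z * w = (u * u') / (v * v')" by (simp add: *)
  moreover have "u * u' \<notin> I" "v * v' \<notin> I" using * I_prime by blast+
  ultimately show ?thesis using * R_mult unfolding U_def by blast
qed

lemma unit_or_p_multiple: assumes "z \<in> V" "z \<notin> U" shows "\<exists>w\<in>V. z = p * w"
proof -
  obtain u v where z: "u \<in> R" "v \<in> R" "v \<notin> I" "v \<noteq> 0" "z = u / v" using assms by (elim VE)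
  have "u \<in> I" using z assms by (auto simp: U_def)
  then obtain w where "w \<in> V" "u = p * w" using I_eq_p_mult by blast
  moreover have "1 / v \<in> V" using z VI R_1 by blast
  ultimately show ?thesis using z V_mult[of w "1 / v"] by (intro bexI[of _ "w * (1 / v)"]) auto
qed

text \<open>
  Some multiple of \<open>u\<close> is a nonzero polynomial in \<open>x\<close>. The order of that polynomial at \<open>a\<close> bounds the
  divisibility of \<open>u\<close> by \<open>x - a\<close>.
\<close>

lemma not_infinitely_divisible:
  assumes "u \<in> R" "u \<noteq> 0" shows "\<exists>k. \<forall>w\<in>V. u \<noteq> p ^ k * w"
proof -
  obtain Q D where QD: "D \<in> R" "Q \<noteq> 0" "u * D = ev Q" using multiple_in_polynomials assms by blast
  obtain Q1 where Q1: "Q = [:- a, 1:] ^ Polynomial.order a Q * Q1" "\<not> [:- a, 1:] dvd Q1"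
    using order_decomp[OF QD(2)] by blast
  let ?k = "Polynomial.order a Q"
  have evQ: "ev Q = p ^ ?k * ev Q1"
    by (subst Q1(1)) (simp add: ev_mult ev_power ev_linear)
  have "u \<noteq> p ^ Suc ?k * w" if w: "w \<in> V" for w
  proof
    assume u: "u = p ^ Suc ?k * w"
    have "p ^ ?k * ev Q1 = u * D" by (simp add: QD(3) evQ)
    also have "\<dots> = p ^ ?k * (p * (w * D))" by (simp add: u mult_ac)
    finally have "p ^ ?k * ev Q1 = p ^ ?k * (p * (w * D))" .
    then have eq: "ev Q1 = p * (w * D)" using p_nonzero by simp
    obtain r v where wD: "r \<in> R" "v \<in> R" "v \<notin> I" "v \<noteq> 0" "w * D = r / v"
      using V_mult[OF w R_subset_V[OF QD(1)]] by (elim VE)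
    have "ev Q1 * v = p * r" using eq wD by simp
    then have "v * ev Q1 \<in> I" using wD p_mult_I by (simp add: mult.commute)
    then have "ev Q1 \<in> I" using I_prime wD R_ev by blast
    then have "ev Q1 - p * ev (synthetic_div Q1 a) \<in> I" by (intro I_diff p_mult_I R_ev)
    then have "emb (poly Q1 a) \<in> I" by (simp add: ev_remainder[of Q1 a] p_def)
    then have "poly Q1 a = 0" by (rule constant_in_I)
    then show False using Q1(2) by (simp add: poly_eq_0_iff_dvd)
  qed
  then show ?thesis by blast
qed

lemma power_times_unit: assumes "u \<in> R" "u \<noteq> 0" shows "\<exists>k. \<exists>w\<in>U. u = p ^ k * w"
proof (rule ccontr)
  assume not: "\<not> ?thesis"
  have "\<exists>w\<in>V. u = p ^ k * w" for k
  proof (induction k)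
    case 0
    then show ?case using R_subset_V assms by simp
  next
    case (Suc k)
    then obtain w where w: "w \<in> V" "u = p ^ k * w" by blast
    then have "w \<notin> U" using not by blast
    then obtain w' where "w' \<in> V" "w = p * w'" using unit_or_p_multiple w by blast
    then show ?case using w by (intro bexI[of _ w']) (auto simp: algebra_simps)
  qed
  then show False using not_infinitely_divisible[OF assms] by blast
qed

text \<open>
  Numerator and denominator of \<open>z\<close> are powers of \<open>x - a\<close> times units, hence so is \<open>z\<close>, with an exponent
  that may be negative.
\<close>

lemma V_or_inverse_V: "z \<in> V \<or> inverse z \<in> V"
proof (cases "z = 0")
  case True
  then show ?thesis using R_subset_V R_0 by simp
next
  case False
  obtain u v where uv: "u \<in> R" "v \<in> R" "v \<noteq> 0" "z = u / v" by (rule fraction_of_R)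
  then have "u \<noteq> 0" using False by auto
  obtain k w where k: "w \<in> U" "u = p ^ k * w" using power_times_unit uv \<open>u \<noteq> 0\<close> by blast
  obtain l w' where l: "w' \<in> U" "v = p ^ l * w'" using power_times_unit uv by blast
  have W: "w * inverse w' \<in> V" "w' * inverse w \<in> V"
    using k l U_mult U_inverse U_subset_V by blast+
  have pV: "p ^ i \<in> V" for i by (intro V_power R_subset_V p_R)
  note nz = p_nonzero U_nonzero[OF k(1)] U_nonzero[OF l(1)]
  show ?thesis
  proof (cases "l \<le> k")
    case True
    then have "p ^ k = p ^ (k - l) * p ^ l" by (simp flip: power_add)
    then have "z = p ^ (k - l) * (w * inverse w')"
      using uv(3,4) k(2) l(2) nz by (auto simp: field_simps)
    then show ?thesis using V_mult[OF pV W(1)] by metis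
  next
    case False
    then have "p ^ l = p ^ (l - k) * p ^ k" by (simp flip: power_add)
    then have "inverse z = p ^ (l - k) * (w' * inverse w)"
      using uv(4) \<open>u \<noteq> 0\<close> k(2) l(2) nz by (auto simp: field_simps)
    then show ?thesis using V_mult[OF pV W(2)] by metis
  qed
qed

lemma p_non_unit: "p \<in> non_units V"
  using quotient_non_unit[OF p_mult_I[OF R_1] R_1 one_notin_I] by simp

lemma valuation_ring_V: "valuation_ring_over emb V"
proof -
  have "range emb \<subseteq> V" using R_subset_V R_emb by auto
  moreover have "x \<notin> range emb"
  proof
    assume "x \<in> range emb"
    then obtain c where "x = emb c" by blast
    moreover have "ev [:- c, 1:] = x - emb c" by (simp add: ev_pCons emb_one emb_uminus)
    ultimately have "ev [:- c, 1:] = 0" by simp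
    then show False by simp
  qed
  moreover have "inverse p \<notin> V"
    using p_non_unit p_nonzero by (auto simp: non_units_def)
  ultimately show ?thesis
    using R_subset_V[OF R_x] V_diff V_mult V_or_inverse_V unfolding valuation_ring_over_def by blast
qed

lemma residue_constant: assumes "z \<in> V" shows "\<exists>c. z - emb c \<in> non_units V"
proof -
  obtain u v where z: "u \<in> R" "v \<in> R" "v \<notin> I" "v \<noteq> 0" "z = u / v" using assms by (elim VE)
  obtain c where c: "u - emb c \<in> I" using constant_plus_I z by blast
  obtain d where d: "v - emb d \<in> I" using constant_plus_I z by blast
  have "d \<noteq> 0" using d z by auto
  have "emb (c / d) * emb d = emb c" using \<open>d \<noteq> 0\<close> by (simp flip: emb_mult)
  then have "u - emb (c / d) * v = (u - emb c) - emb (c / d) * (v - emb d)" by (simp add: algebra_simps)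
  also have "\<dots> \<in> I" by (intro I_diff I_mult R_emb c d)
  finally have "u - emb (c / d) * v \<in> I" .
  then have "(u - emb (c / d) * v) / v \<in> non_units V" using quotient_non_unit z by blast
  moreover have "(u - emb (c / d) * v) / v = z - emb (c / d)"
    using z by (simp add: diff_divide_distrib)
  ultimately show ?thesis by auto
qed

theorem rational_point_over_a: "\<exists>P\<in>affine_rational_points emb x. x - emb a \<in> non_units P"
  using valuation_ring_V residue_constant p_non_unit[unfolded p_def]
  by (intro bexI[of _ V]) (auto simp: affine_rational_points_def rational_points_def)

end

section \<open>Transitivity bounds the number of split points\<close>

lemma non_units_mult:
  assumes "valuation_ring_over emb V" "z \<in> non_units V" "u \<in> V"
  shows "u * z \<in> non_units V"
proof -
  have mult: "v * w \<in> V" if "v \<in> V" "w \<in> V" for v w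
    using assms(1) that by (simp add: valuation_ring_over_def)
  have "u * z * w \<noteq> 1" if "w \<in> V" for w
    using assms(2) mult[OF assms(3) that] by (auto simp: non_units_def mult_ac)
  then show ?thesis using assms mult by (simp add: non_units_def)
qed

text \<open>One of \<open>z\<close> and \<open>w\<close> divides the other, and hence also the difference.\<close>

lemma non_units_diff:
  assumes V: "valuation_ring_over emb V" and z: "z \<in> non_units V" and w: "w \<in> non_units V"
  shows "z - w \<in> non_units V"
proof -
  have mult: "u * v \<in> V" and diff: "u - v \<in> V" if "u \<in> V" "v \<in> V" for u v
    using V that by (simp_all add: valuation_ring_over_def)
  have zV: "z \<in> V" and wV: "w \<in> V" using z w by (simp_all add: non_units_def)
  have "0 \<in> V" using diff[OF zV zV] by simp
  have "1 \<in> V" using V unfolding valuation_ring_over_def by (metis inverse_1)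
  show ?thesis
  proof (cases "z = 0 \<or> w = 0")
    case True
    have "(0 - 1) * w \<in> non_units V"
      using non_units_mult[OF V w] diff \<open>0 \<in> V\<close> \<open>1 \<in> V\<close> by blast
    with True z show ?thesis by auto
  next
    case False
    have "z / w \<in> V \<or> inverse (z / w) \<in> V" using V unfolding valuation_ring_over_def by blast
    then consider "z / w \<in> V" | "w / z \<in> V" by auto
    then show ?thesis
    proof cases
      case 1
      have "(z / w - 1) * w \<in> non_units V"
        using 1 \<open>1 \<in> V\<close> diff by (intro non_units_mult[OF V w])
      then show ?thesis using False by (simp add: left_diff_distrib)
    next
      case 2
      have "(1 - w / z) * z \<in> non_units V"
        using 2 \<open>1 \<in> V\<close> diff by (intro non_units_mult[OF V z])
      then show ?thesis using False by (simp add: left_diff_distrib)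
    qed
  qed
qed

lemma automorphism_image_non_units:
  assumes "automorphism_over emb h" and "z \<in> non_units V"
  shows "h z \<in> non_units (h ` V)"
proof -
  have h: "bij h" "\<And>u v. h (u * v) = h u * h v" using assms by (auto simp: automorphism_over_def)
  have "h 1 * h 1 = h 1" by (simp flip: h(2))
  moreover have "h 1 \<noteq> 0"
  proof
    assume "h 1 = 0"
    then have "h u = 0" for u using h(2)[of u 1] by simp
    then show False using bij_is_inj[OF h(1)] by (metis injD one_neq_zero)
  qed
  ultimately have h1: "h 1 = 1" by simp
  have "h z * h w \<noteq> 1" if "w \<in> V" for w
  proof
    assume "h z * h w = 1"
    then have "h (z * w) = h 1" by (simp add: h h1)
    then have "z * w = 1" using bij_is_inj[OF h(1)] by (simp add: inj_eq)
    then show False using assms(2) that by (auto simp: non_units_def)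
  qed
  then show ?thesis using assms(2) by (auto simp: non_units_def)
qed

text \<open>
  The inverse of \<open>\<sigma>\<close> scales \<open>x\<close> by \<open>\<kappa>\<^bsup>m-1\<^esup>\<close>, so nonnegative exponents are enough for the whole group.
\<close>

lemma generated_automorphism_scales_x:
  fixes emb :: "'a::field \<Rightarrow> 'l::field"
  assumes tau: "automorphism_over emb \<tau>" "\<tau> x = x"
    and sigma: "automorphism_over emb \<sigma>" "\<sigma> x = emb \<kappa> * x"
    and emb_mult: "\<And>a b. emb (a * b) = emb a * emb b" and emb_1: "emb 1 = 1"
    and "\<kappa> ^ m = 1" "m > 0"
    and h: "h \<in> carrier (subgroup_generated (BijGroup UNIV) {\<tau>, \<sigma>})"
  shows "automorphism_over emb h \<and> (\<exists>i. h x = emb (\<kappa> ^ i) * x)"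
proof -
  let ?G = "BijGroup (UNIV :: 'l set)"
  have carr: "k \<in> carrier ?G \<longleftrightarrow> bij k" for k :: "'l \<Rightarrow> 'l"
    by (simp add: BijGroup_def Bij_def)
  have inv: "automorphism_over emb (inv_into UNIV k)" if "automorphism_over emb k" for k
  proof -
    have k: "bij k" "\<And>u v. k (u + v) = k u + k v" "\<And>u v. k (u * v) = k u * k v" "\<And>a. k (emb a) = emb a"
      using that by (auto simp: automorphism_over_def)
    note s = surj_f_inv_f[OF bij_is_surj[OF k(1)]] and i = inv_f_f[OF bij_is_inj[OF k(1)]]
    show ?thesis unfolding automorphism_over_def
      by (metis bij_imp_bij_inv k s i)
  qed
  from h have "h \<in> generate ?G (carrier ?G \<inter> {\<tau>, \<sigma>})"
    by (simp add: subgroup_generated_def)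
  then show ?thesis
  proof induction
    case one
    have "\<one>\<^bsub>?G\<^esub> = (\<lambda>u. u)" by (simp add: BijGroup_def restrict_def)
    then show ?case
      by (auto simp: automorphism_over_def bij_def emb_1 intro!: exI[of _ 0])
  next
    case (incl k)
    then show ?case using tau sigma emb_1 by (auto intro: exI[of _ 0] exI[of _ 1])
  next
    case (inv k)
    then have k: "automorphism_over emb k" "bij k" using tau sigma carr by auto
    have eq: "inv\<^bsub>?G\<^esub> k = inv_into UNIV k"
      using k by (subst inv_BijGroup) (auto simp: Bij_def restrict_def)
    note s = surj_f_inv_f[OF bij_is_surj[OF k(2)]] and i = inv_f_f[OF bij_is_inj[OF k(2)]]
    have "\<exists>i. inv_into UNIV k x = emb (\<kappa> ^ i) * x"
    proof (cases "k = \<tau>")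
      case True
      then show ?thesis using i[of x] tau(2) emb_1 by (intro exI[of _ 0]) simp
    next
      case False
      then have "k = \<sigma>" using inv by auto
      have "k (emb (\<kappa> ^ (m - 1)) * x) = emb (\<kappa> ^ (m - 1) * \<kappa>) * x"
        using sigma \<open>k = \<sigma>\<close> by (simp add: automorphism_over_def emb_mult)
      also have "\<kappa> ^ (m - 1) * \<kappa> = 1" using assms(7,8) by (simp flip: power_Suc2)
      finally have "k (emb (\<kappa> ^ (m - 1)) * x) = x" by (simp add: emb_1)
      then show ?thesis using i by metis
    qed
    then show ?case using \<open>\<And>k. automorphism_over emb k \<Longrightarrow> automorphism_over emb (inv_into UNIV k)\<close>[OF k(1)] eq by simp
  next
    case (eng h1 h2)
    then obtain i j where ij: "h1 x = emb (\<kappa> ^ i) * x" "h2 x = emb (\<kappa> ^ j) * x" by blast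
    have aut: "automorphism_over emb h1" "automorphism_over emb h2" using eng by auto
    then have "bij h1" "bij h2" by (auto simp: automorphism_over_def)
    then have eq: "h1 \<otimes>\<^bsub>?G\<^esub> h2 = h1 \<circ> h2"
      by (auto simp: BijGroup_def Bij_def compose_def fun_eq_iff)
    have "automorphism_over emb (h1 \<circ> h2)"
      using aut by (auto simp: automorphism_over_def bij_comp)
    moreover have "(h1 \<circ> h2) x = emb (\<kappa> ^ (i + j)) * x"
      using aut ij by (simp add: automorphism_over_def emb_mult power_add mult_ac)
    ultimately show ?case using eq by metis
  qed
qed

lemma card_powers_le:
  fixes k :: "'a::field"
  assumes "k ^ m = 1" "m > 0"
  shows "card (range (\<lambda>i. k ^ i * a)) \<le> m"
proof -
  have "k ^ i * a \<in> (\<lambda>i. k ^ i * a) ` {..<m}" for i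
  proof -
    have "k ^ i = k ^ (m * (i div m) + i mod m)" by simp
    also have "\<dots> = k ^ (i mod m)" by (simp only: power_add power_mult assms) simp
    finally show ?thesis using assms(2) by (intro image_eqI[of _ _ "i mod m"]) auto
  qed
  then have "card (range (\<lambda>i. k ^ i * a)) \<le> card ((\<lambda>i. k ^ i * a) ` {..<m})"
    by (intro card_mono) auto
  also have "\<dots> \<le> m" using card_image_le[of "{..<m}"] by simp
  finally show ?thesis .
qed

section \<open>The window\<close>

text \<open>
  The genus and \<open>M\<close> are defined by integer division. The next two lemmas free them from it; this matters
  because the bounds below are attained, for instance for \<open>q = 4\<close> and \<open>n = d = m = 3\<close>.
\<close>

lemma two_times_curve_genus:
  fixes f :: "'a::finite_field poly"
  assumes "n > 0" "degree f > 0"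
  shows "2 * curve_genus n f = (int n - 1) * (int (degree f) - 1) + 1 - curve_c n f"
proof -
  have "even ((int n - 1) * (int (degree f) - 1) + 1 - int (gcd n (degree f)))"
  proof (cases "even n \<and> even (degree f)")
    case True
    then have "even (gcd n (degree f))" by simp
    with True show ?thesis by simp
  next
    case False
    then have "odd (gcd n (degree f))" by (auto dest: dvd_trans)
    with False show ?thesis by auto
  qed
  then show ?thesis by (simp add: curve_genus_def curve_c_def)
qed

lemma curve_c_times_window_M:
  fixes f :: "'a::finite_field poly"
  assumes "n > 0"
  shows "curve_c n f * window_M n f = (int CARD('a) - 1) * int n - curve_c n f"
proof -
  have "curve_c n f dvd (int CARD('a) - 1) * int n" by (simp add: curve_c_def)
  then have "curve_c n f * ((int CARD('a) - 1) * int n div curve_c n f) = (int CARD('a) - 1) * int n"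
    by simp
  then show ?thesis by (simp add: window_M_def right_diff_distrib)
qed

text \<open>
  In the next two lemmas \<open>Q\<close> is \<open>q - 1\<close>, and the hypothesis on \<open>t\<close> is what the estimate \<open>2 \<mu>(s) \<le> M\<close> gives for
  \<open>t(s)\<close>.
\<close>

lemma window_bound_small:
  fixes n d m Q c t \<delta> :: int
  assumes "n \<ge> 2" "d \<ge> 3" "c \<le> n" "2 * m \<le> Q" "\<delta> \<ge> Q + 1 - m"
    and t: "2 * t \<ge> 2 * (n - 1) * (d - 1) - 2 - c - Q * n + 2 * n * \<delta>"
  shows "t \<ge> 0"
proof -
  have "(n - 1) * 2 \<le> (n - 1) * (d - 1)" using assms by (intro mult_left_mono) auto
  moreover have "n * (Q + 2) \<le> n * (2 * \<delta>)" using assms by (intro mult_left_mono) auto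
  ultimately have "0 \<le> 2 * t"
    using t assms(1-5) unfolding ring_distribs by (simp only: mult_ac)
  then show ?thesis by simp
qed

lemma window_bound_large:
  fixes n d Q c t \<delta> :: int
  assumes "n \<ge> 3" "Q \<ge> 3" "d \<ge> Q" "c \<le> n" "\<delta> \<ge> 1"
    and t: "2 * t \<ge> 2 * (n - 1) * (d - 1) - 2 - c - Q * n + 2 * n * \<delta>"
  shows "t \<ge> 0"
proof -
  have "(n - 1) * (Q - 1) \<le> (n - 1) * (d - 1)" using assms by (intro mult_left_mono) auto
  moreover have "n \<le> n * \<delta>" using mult_left_mono[of 1 \<delta> n] assms by simp
  moreover have "1 * 2 \<le> (n - 2) * (Q - 1)" using assms by (intro mult_mono) auto
  ultimately have "0 \<le> 2 * t"
    using t assms(1-5) unfolding ring_distribs by (simp only: mult_ac)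
  then show ?thesis by simp
qed

text \<open>
  For \<open>n = 2\<close> and \<open>m = q - 1\<close> the estimate \<open>2 \<mu>(s) \<le> M\<close> is too weak by one. There \<open>M = q - 2\<close> is odd, hence
  \<open>2 \<mu>(s) \<le> M - 1\<close>, and this saves the bound.
\<close>

lemma window_empty:
  fixes f :: "'a::finite_field poly"
  assumes n: "n \<ge> 2" and d: "degree f \<ge> 3" and nq: "n dvd CARD('a) - 1"
    and mq: "m dvd CARD('a) - 1" and md: "m dvd degree f" and m: "m > 0"
    and split: "CARD('a) - m \<le> num_non_split n f"
  shows "curve_window n f = {}"
proof -
  define Q where "Q = int CARD('a) - 1"
  let ?c = "curve_c n f" and ?d = "int (degree f)" and ?\<delta> = "int (num_non_split n f)"
  have card: "CARD('a) \<ge> 2"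
    using card_mono[of "UNIV :: 'a set" "{0, 1}"] by simp
  have Q: "int (CARD('a) - 1) = Q" using card by (simp add: Q_def)
  have Qpos: "Q > 0" using card by (simp add: Q_def)
  have nQ: "int n \<le> Q" using nq Qpos Q by (metis zdvd_imp_le int_dvd_int_iff)
  have mQ: "int m dvd Q" using mq Q by (metis int_dvd_int_iff)
  then have mQ': "int m \<le> Q" using Qpos by (intro zdvd_imp_le)
  have delta: "?\<delta> \<ge> Q + 1 - int m" using split by (simp add: Q_def)
  have c: "?c \<le> int n" "?c > 0"
    using n by (auto simp: curve_c_def intro: dvd_imp_le)
  have g: "2 * curve_genus n f = (int n - 1) * (?d - 1) + 1 - ?c"
    using n d by (intro two_times_curve_genus) auto
  have cM: "?c * window_M n f = Q * int n - ?c"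
    using curve_c_times_window_M[of n f] n by (simp add: Q_def)
  have "window_t n f s \<ge> 0" for s
  proof -
    let ?\<mu> = "window_mu n f s"
    have mu: "2 * ?\<mu> \<le> window_M n f" by (simp add: window_mu_def min_def)
    have "?c * (2 * ?\<mu>) \<le> ?c * window_M n f" using mu c by (intro mult_left_mono) auto
    then have t: "2 * window_t n f s \<ge> 2 * (int n - 1) * (?d - 1) - 2 - ?c - Q * int n + 2 * int n * ?\<delta>"
      using g cM by (simp add: window_t_def algebra_simps)
    show ?thesis
    proof (cases "2 * int m \<le> Q")
      case True
      then show ?thesis
        using window_bound_small[OF _ _ c(1) True delta t] n d by simp
    next
      case False
      obtain k where k: "Q = int m * k" using mQ by auto
      have "k = 1"
      proof (rule ccontr)
        assume "k \<noteq> 1"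
        have "k > 0" using k Qpos m by (metis zero_less_mult_pos of_nat_0_less_iff)
        then have "int m * 2 \<le> int m * k" using \<open>k \<noteq> 1\<close> by (intro mult_left_mono) auto
        then show False using False k by simp
      qed
      then have mQ: "Q = int m" using k by simp
      then have dQ: "Q \<le> ?d" using md d by (auto intro: dvd_imp_le)
      show ?thesis
      proof (cases "n = 2")
        case False
        then show ?thesis
          using window_bound_large[OF _ _ dQ c(1) _ t] n nQ delta mQ by simp
      next
        case True
        have "even Q" using True nq Q by (metis even_of_nat)
        have "even (degree f)" using md mQ \<open>even Q\<close> by (meson dvd_trans even_of_nat)
        then have c2: "?c = 2" using True by (simp add: curve_c_def gcd_nat.absorb1)
        have "window_M n f = Q - 1" using cM c2 True by simp
        then have "2 * ?\<mu> \<le> Q - 1" using mu by simp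
        then have "2 * ?\<mu> \<le> Q - 2" using \<open>even Q\<close> by presburger
        then show ?thesis
          using g c2 True delta mQ dQ by (simp add: window_t_def)
      qed
    qed
  qed
  then show ?thesis by (auto simp: curve_window_def not_less)
qed

theorem proposition5p5:
  fixes f g :: "'a::finite_field poly"
    and n d m :: nat
    and \<zeta> \<kappa> :: 'a
    and emb :: "'a \<Rightarrow> 'l::field"
    and x y :: 'l
    and \<tau> \<sigma> :: "'l \<Rightarrow> 'l"
  assumes "n \<ge> 2" and "d \<ge> 3"
    and "n dvd CARD('a) - 1"
    and "degree f = d"
    and "coprime f (pderiv f)"
    and "\<And>a. poly f a \<noteq> 0"
    and "curve_function_field emb x y n f"
    and "m > 0" and "m dvd exponent_gcd f"
    and "\<kappa> \<noteq> 0" and "elem_order \<kappa> = m"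
    and "f = pcompose g (monom 1 m)"
    and "poly g 0 \<notin> unit_powers n"
    and "\<zeta> \<noteq> 0" and "elem_order \<zeta> = n"
    and "automorphism_over emb \<tau>" and "\<tau> x = x" and "\<tau> y = emb \<zeta> * y"
    and "automorphism_over emb \<sigma>" and "\<sigma> x = emb \<kappa> * x" and "\<sigma> y = y"
    and "transitive_action (subgroup_generated (BijGroup UNIV) {\<tau>, \<sigma>})
           (affine_rational_points emb x) (point_action (affine_rational_points emb x))"
  shows "curve_window n f = {} \<and> \<not> totally_split n f"
proof -
  let ?S = "{a. poly f a \<in> unit_powers n}" and ?Y = "affine_rational_points emb x"
  have kappa: "\<kappa> ^ m = 1" using elem_order_pos_power[of \<kappa>] assms by auto
  have n_pos: "n > 0" using assms(1) by simp
  interpret curve: kummer_curve emb x y n f \<tau> \<zeta>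
  proof -
    interpret curve_function_field emb x y n f by fact
    show "kummer_curve emb x y n f \<tau> \<zeta>"
    proof
      show "\<zeta> ^ n = 1" using elem_order_pos_power[of \<zeta>] assms by auto
      show "\<zeta> ^ k \<noteq> 1" if "0 < k" "k < n" for k
        using power_below_elem_order[of k \<zeta>] that assms by auto
      show "of_nat n \<noteq> (0 :: 'a)" using of_nat_divisor_card_minus_one_nonzero assms by blast
    qed (use assms n_pos in auto)
  qed
  interpret action: transitive_action "subgroup_generated (BijGroup UNIV) {\<tau>, \<sigma>}" ?Y "point_action ?Y"
    by fact
  have point: "\<exists>P\<in>?Y. x - emb a \<in> non_units P" if "a \<in> ?S" for a
  proof -
    obtain b where "b \<noteq> 0" "poly f a = b ^ n" using \<open>a \<in> ?S\<close> by (auto simp: unit_powers_def)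
    then interpret split_point emb x y n f \<tau> \<zeta> a b by unfold_locales
    show ?thesis by (rule rational_point_over_a)
  qed
  have same_orbit: "a \<in> range (\<lambda>i. \<kappa> ^ i * a')" if S: "a \<in> ?S" "a' \<in> ?S" for a a'
  proof -
    obtain P P' where P: "P \<in> ?Y" "x - emb a \<in> non_units P" and P': "P' \<in> ?Y" "x - emb a' \<in> non_units P'"
      using point[OF S(1)] point[OF S(2)] by blast
    obtain h where h: "h \<in> carrier (subgroup_generated (BijGroup UNIV) {\<tau>, \<sigma>})" "point_action ?Y h P = P'"
      using action.unique_orbit[OF P(1) P'(1)] by blast
    have aut: "automorphism_over emb h" and "\<exists>i. h x = emb (\<kappa> ^ i) * x"
      using generated_automorphism_scales_x[OF assms(16,17,19,20) curve.emb_mult curve.emb_one kappa \<open>m > 0\<close> h(1)] by auto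
    then obtain i where i: "h x = emb (\<kappa> ^ i) * x" by blast
    have "h ` P = P'" using h(2) P(1) by (simp add: point_action_def)
    then have "h (x - emb a) \<in> non_units P'" using automorphism_image_non_units[OF aut P(2)] by simp
    moreover have "h (x - emb a) = emb (\<kappa> ^ i) * x - emb a"
    proof -
      have "h (x - emb a) + h (emb a) = h x" using aut unfolding automorphism_over_def by (metis diff_add_cancel)
      then show ?thesis using i aut by (simp add: automorphism_over_def algebra_simps)
    qed
    ultimately have 1: "emb (\<kappa> ^ i) * x - emb a \<in> non_units P'" by simp
    have val: "valuation_ring_over emb P'" using P'(1) by (simp add: affine_rational_points_def rational_points_def)
    \<comment> \<open>At the point \<open>P'\<close> the function \<open>x\<close> takes the value \<open>a'\<close>, and \<open>\<kappa>\<^sup>i x\<close> the value \<open>a\<close>.\<close>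
    have "\<kappa> ^ i * a' = a"
    proof (rule ccontr)
      assume ne: "\<kappa> ^ i * a' \<noteq> a"
      have "emb (\<kappa> ^ i) * (x - emb a') \<in> non_units P'"
        using val by (intro non_units_mult[OF val P'(2)]) (auto simp: valuation_ring_over_def)
      from non_units_diff[OF val 1 this]
      have "emb (\<kappa> ^ i * a' - a) \<in> non_units P'"
        by (simp add: curve.emb_diff curve.emb_mult algebra_simps)
      moreover have "emb (inverse (\<kappa> ^ i * a' - a)) \<in> P'"
        using val by (auto simp: valuation_ring_over_def)
      moreover have "emb (\<kappa> ^ i * a' - a) * emb (inverse (\<kappa> ^ i * a' - a)) = 1"
        using ne by (simp add: curve.emb_one flip: curve.emb_mult)
      ultimately show False unfolding non_units_def by blast
    qed
    then show ?thesis by blast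
  qed
  have "card ?S \<le> m"
  proof (cases "?S = {}")
    case False
    then obtain a' where "a' \<in> ?S" by blast
    then have "?S \<subseteq> range (\<lambda>i. \<kappa> ^ i * a')" using same_orbit by blast
    then have "card ?S \<le> card (range (\<lambda>i. \<kappa> ^ i * a'))" by (intro card_mono) auto
    also have "\<dots> \<le> m" by (rule card_powers_le[OF kappa \<open>m > 0\<close>])
    finally show ?thesis .
  qed simp
  moreover have "num_non_split n f = CARD('a) - card ?S"
    unfolding num_non_split_def
    by (subst card_Diff_subset[symmetric]) (auto intro: arg_cong[where f = card])
  ultimately have "CARD('a) - m \<le> num_non_split n f" by simp
  moreover have "m dvd CARD('a) - 1" "m dvd degree f"
  proof -
    have dvd: "m dvd k" if "k \<in> insert (CARD('a) - 1) {i. coeff f i \<noteq> 0}" for k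
      using \<open>m dvd exponent_gcd f\<close> that unfolding exponent_gcd_def by (meson Gcd_dvd dvd_trans)
    then show "m dvd CARD('a) - 1" by simp
    have "f \<noteq> 0" using \<open>\<And>a. poly f a \<noteq> 0\<close> by auto
    then show "m dvd degree f" using dvd by simp
  qed
  ultimately have "curve_window n f = {}" using assms by (intro window_empty) auto
  moreover have "poly f 0 \<notin> unit_powers n"
    using assms by (simp add: poly_pcompose poly_monom zero_power)
  ultimately show ?thesis by (auto simp: totally_split_def)
qed

end
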